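(* Let $m,n\ge 1$ be integers, let $p_1,\dots,p_m>0$ with $\sum_{i=1}^m p_i=1$, and let $Y=(Y_1,\dots,Y_n)$ be a vector of i.i.d. random variables with $P(Y_\ell=i)=p_i$ for all $i\in[m]$ and $\ell\in[n]$. Let $\mathcal N_n$ be the empirical nerve (random interval graph) of $Y$. For any pair $1\le i<j\le m$, let $A_{ij}$ be the event that the edge $\{i,j\}$ is present in $\mathcal N_n$, and let $q_{ij}=1-(p_i+p_j)$. Then $$P(A_{ij})=1-q_{ij}^n-\sum_{k=1}^n\binom nk\left[\left(2\sum_{r=1}^{k-1}p_i^r p_j^{k-r}\right)+p_i^k+p_j^k\right]q_{ij}^{\,n-k}.$$ When $p_i=\frac1m$ for all $i\in[m]$, this gives $$P(A_{ij})=1-\frac{2n(m-1)^{n-1}+(m-2)^n}{m^n}.$$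
   Context: Notation: $[N]=\{1,\dots,N\}$. For each label $i\in[m]$, the empirical support is $I_n(i)=\mathrm{Conv}(\{\ell\in[n]:Y_\ell=i\})\subset\mathbb R$, i.e. the closed interval from the first to the last index at which label $i$ occurs (possibly a single point; empty if label $i$ does not occur). The empirical nerve $\mathcal N_n$ is the abstract simplicial complex whose simplices are the nonempty subsets $J\subseteq[m]$ with $\bigcap_{i\in J}I_n(i)\ne\emptyset$; its 1-skeleton, denoted by the same symbol, is the graph whose vertices are the labels $i$ with $I_n(i)\neq\emptyset$ and in which $\{i,j\}$, $i\ne j$, is an edge iff $I_n(i)\cap I_n(j)\neq\emptyset$. Convention: $0^0=1$. *)

theory Defs
  imports "HOL-Probability.Probability"
begin

definition empirical_support :: "nat \<Rightarrow> (nat \<Rightarrow> nat) \<Rightarrow> nat \<Rightarrow> real set" where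
  "empirical_support n y i = convex hull (real ` {l \<in> {1..n}. y l = i})"

definition empirical_nerve :: "nat \<Rightarrow> nat \<Rightarrow> (nat \<Rightarrow> nat) \<Rightarrow> nat set set" where
  "empirical_nerve m n y =
     {J. J \<noteq> {} \<and> J \<subseteq> {1..m} \<and> (\<Inter>i\<in>J. empirical_support n y i) \<noteq> {}}"

definition nerve_vertices :: "nat \<Rightarrow> nat \<Rightarrow> (nat \<Rightarrow> nat) \<Rightarrow> nat set" where
  "nerve_vertices m n y = {i \<in> {1..m}. empirical_support n y i \<noteq> {}}"

definition nerve_edges :: "nat \<Rightarrow> nat \<Rightarrow> (nat \<Rightarrow> nat) \<Rightarrow> nat set set" where
  "nerve_edges m n y =
     {{i, j} | i j. i \<in> nerve_vertices m n y \<and> j \<in> nerve_vertices m n y \<and> i \<noteq> j \<and>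
        empirical_support n y i \<inter> empirical_support n y j \<noteq> {}}"

lemma nerve_vertices_iff: "i \<in> nerve_vertices m n y \<longleftrightarrow> {i} \<in> empirical_nerve m n y"
  by (auto simp: nerve_vertices_def empirical_nerve_def)

lemma nerve_edges_eq: "nerve_edges m n y = {J \<in> empirical_nerve m n y. card J = 2}"
proof (intro equalityI subsetI)
  fix J assume "J \<in> nerve_edges m n y"
  then show "J \<in> {J \<in> empirical_nerve m n y. card J = 2}"
    by (auto simp: nerve_edges_def nerve_vertices_def empirical_nerve_def)
next
  fix J assume "J \<in> {J \<in> empirical_nerve m n y. card J = 2}"
  then have J: "J \<in> empirical_nerve m n y" and "card J = 2"
    by auto
  from this(2) obtain i j where ij: "J = {i, j}" "i \<noteq> j"
    by (auto simp: card_2_iff)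
  with J have "i \<in> nerve_vertices m n y" "j \<in> nerve_vertices m n y"
      "empirical_support n y i \<inter> empirical_support n y j \<noteq> {}"
    by (auto simp: nerve_vertices_def empirical_nerve_def)
  with ij show "J \<in> nerve_edges m n y"
    unfolding nerve_edges_def mem_Collect_eq by (intro exI[of _ i] exI[of _ j] conjI)
qed

end

theory Submission
  imports Defs
begin

text \<open>
  Say that \<open>i\<close> precedes \<open>j\<close> in a word if every occurrence of \<open>i\<close> lies strictly before every
  occurrence of \<open>j\<close>. The supports of \<open>i \<noteq> j\<close> are disjoint iff \<open>i\<close> precedes \<open>j\<close> or \<open>j\<close> precedes \<open>i\<close>,
  and both happen together iff one of the two labels is absent. With \<open>u n\<close> the probability that \<open>i\<close>
  precedes \<open>j\<close>, inclusion-exclusion leaves only \<open>u n\<close>, and looking at the last letter gives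
  \<open>u (n + 1) = (1 - p i) * u n + p i * (1 - p j) ^ n\<close>. By Pascal's rule the same recursion is
  satisfied by the sum of \<open>(n choose k) * (\<Sum>r\<le>k. p i ^ r * p j ^ (k - r)) * q ^ (n - k)\<close>
  over \<open>k\<close>.
\<close>

definition precedes :: "nat \<Rightarrow> (nat \<Rightarrow> nat) \<Rightarrow> nat \<Rightarrow> nat \<Rightarrow> bool" where
  "precedes n y i j \<longleftrightarrow> (\<forall>a\<in>{1..n}. \<forall>b\<in>{1..n}. y a = i \<longrightarrow> y b = j \<longrightarrow> a < b)"

text \<open>A set of letters is taken because inclusion-exclusion needs \<open>{}\<close> (total
  mass), \<open>{i}\<close>, \<open>{j}\<close> and \<open>{i, j}\<close>.\<close>

definition avoids :: "nat \<Rightarrow> (nat \<Rightarrow> nat) \<Rightarrow> nat set \<Rightarrow> bool" where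
  "avoids n y B \<longleftrightarrow> (\<forall>l\<in>{1..n}. y l \<notin> B)"

text \<open>The mass of \<open>Q\<close> under the product law on words of length \<open>n\<close>.
  Extensional words form a finite set, so the recursions below need no measure theory.\<close>

definition word_weight :: "nat \<Rightarrow> (nat \<Rightarrow> real) \<Rightarrow> nat \<Rightarrow> ((nat \<Rightarrow> nat) \<Rightarrow> bool) \<Rightarrow> real" where
  "word_weight m p n Q =
     (\<Sum>y\<in>{1..n} \<rightarrow>\<^sub>E {1..m}. of_bool (Q y) * (\<Prod>l\<in>{1..n}. p (y l)))"

text \<open>This is n! times the coefficient of x^n in e^(q x) F(x), with F the exponential
  generating function of \<open>f\<close>; the recursion in \<open>n\<close> is then the product
  rule for derivatives.\<close>

definition binomial_transform :: "real \<Rightarrow> (nat \<Rightarrow> real) \<Rightarrow> nat \<Rightarrow> real" where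
  "binomial_transform q f n = (\<Sum>k\<le>n. real (n choose k) * f k * q ^ (n - k))"

subsection \<open>Disjoint supports\<close>

text \<open>The last occurrence of \<open>i\<close> separates the two hulls, since half-lines are
  convex; if \<open>i\<close> is absent, its hull is empty.\<close>

lemma disjoint_support_if_precedes:
  assumes "precedes n y i j"
  shows "empirical_support n y i \<inter> empirical_support n y j = {}"
proof (cases "\<exists>l\<in>{1..n}. y l = i")
  case True
  define X where "X = {l \<in> {1..n}. y l = i}"
  have X: "finite X" "X \<noteq> {}" using True by (auto simp: X_def)
  have "empirical_support n y i \<subseteq> {..real (Max X)}"
    unfolding empirical_support_def
    using Max_ge[OF X(1)] by (intro hull_minimal) (auto simp: X_def)
  moreover have "empirical_support n y j \<subseteq> {real (Max X)<..}"
    unfolding empirical_support_def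
  proof (rule hull_minimal)
    show "real ` {l \<in> {1..n}. y l = j} \<subseteq> {real (Max X)<..}"
      using Max_in[OF X] assms by (auto simp: X_def precedes_def)
  qed auto
  ultimately show ?thesis by fastforce
next
  case False
  then have "{l \<in> {1..n}. y l = i} = {}" by blast
  then show ?thesis unfolding empirical_support_def by (simp only: image_empty convex_hull_empty Int_empty_left)
qed

lemma between_in_empirical_support:
  assumes "a \<in> {1..n}" "c \<in> {1..n}" "y a = i" "y c = i" "a \<le> b" "b \<le> c"
  shows "real b \<in> empirical_support n y i"
proof -
  have "closed_segment (real a) (real c) \<subseteq> empirical_support n y i"
    unfolding empirical_support_def using assms
    by (intro closed_segment_subset_convex_hull hull_inc) auto
  then show ?thesis using assms by (auto simp: closed_segment_eq_real_ivl)
qed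

lemma edge_iff_not_precedes:
  assumes "i \<in> {1..m}" "j \<in> {1..m}" "i \<noteq> j"
  shows "{i, j} \<in> nerve_edges m n y \<longleftrightarrow> \<not> precedes n y i j \<and> \<not> precedes n y j i"
proof
  assume "{i, j} \<in> nerve_edges m n y"
  then have "empirical_support n y i \<inter> empirical_support n y j \<noteq> {}"
    by (auto simp: nerve_edges_def doubleton_eq_iff)
  then show "\<not> precedes n y i j \<and> \<not> precedes n y j i"
    using disjoint_support_if_precedes by blast
next
  assume "\<not> precedes n y i j \<and> \<not> precedes n y j i"
  then obtain a b a' b' where
    ab: "a \<in> {1..n}" "b \<in> {1..n}" "y a = i" "y b = j" "b \<le> a" and
    ab': "a' \<in> {1..n}" "b' \<in> {1..n}" "y a' = i" "y b' = j" "a' \<le> b'"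
    unfolding precedes_def by (meson not_le)
  \<comment> \<open>The common point is the larger of \<open>a'\<close> and \<open>b\<close>: either
    \<open>a' \<le> b \<le> a\<close>, or \<open>b < a' \<le> b'\<close>.\<close>
  have "\<exists>c. real c \<in> empirical_support n y i \<and> real c \<in> empirical_support n y j"
  proof (cases "a' \<le> b")
    case True
    then show ?thesis
      using between_in_empirical_support[of a' n a y i b] between_in_empirical_support[of b n b y j b] ab ab'
      by blast
  next
    case False
    then show ?thesis
      using between_in_empirical_support[of a' n a' y i a'] between_in_empirical_support[of b n b' y j a'] ab ab'
      by auto
  qed
  then show "{i, j} \<in> nerve_edges m n y"
    using assms unfolding nerve_edges_def nerve_vertices_def by blast
qed

lemma precedes_both_iff:
  assumes "i \<noteq> j"
  shows "precedes n y i j \<and> precedes n y j i \<longleftrightarrow> avoids n y {i} \<or> avoids n y {j}"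
proof
  assume both: "precedes n y i j \<and> precedes n y j i"
  show "avoids n y {i} \<or> avoids n y {j}"
  proof (rule ccontr)
    assume "\<not> (avoids n y {i} \<or> avoids n y {j})"
    then obtain a b where "a \<in> {1..n}" "b \<in> {1..n}" "y a = i" "y b = j"
      by (auto simp: avoids_def)
    then have "a < b" "b < a" using both by (auto simp: precedes_def)
    then show False by simp
  qed
qed (auto simp: precedes_def avoids_def)

subsection \<open>Weights of sets of words\<close>

lemma word_weight_Suc:
  "word_weight m p (Suc n) Q = (\<Sum>a=1..m. p a * word_weight m p n (\<lambda>y. Q (y(Suc n := a))))"
proof -
  define g where "g y = of_bool (Q y) * (\<Prod>l\<in>{1..Suc n}. p (y l))" for y :: "nat \<Rightarrow> nat"
  let ?P = "{1..n} \<rightarrow>\<^sub>E {1..m}"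
  have PiE: "{1..Suc n} \<rightarrow>\<^sub>E {1..m} = (\<lambda>(a, y). y(Suc n := a)) ` ({1..m} \<times> ?P)"
    by (simp add: atLeastAtMostSuc_conv PiE_insert_eq)
  have inj: "inj_on (\<lambda>(a, y). y(Suc n := a)) ({1..m} \<times> ?P)"
    using inj_combinator[of "Suc n" "{1..n}" "\<lambda>_. {1..m}"] by simp
  have "word_weight m p (Suc n) Q = (\<Sum>y\<in>{1..Suc n} \<rightarrow>\<^sub>E {1..m}. g y)"
    by (simp add: word_weight_def g_def)
  also have "\<dots> = (\<Sum>(a, y)\<in>{1..m} \<times> ?P. g (y(Suc n := a)))"
    unfolding PiE sum.reindex[OF inj] by (simp add: case_prod_unfold)
  also have "\<dots> = (\<Sum>a=1..m. \<Sum>y\<in>?P. g (y(Suc n := a)))"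
    by (simp add: sum.cartesian_product)
  also have "\<dots> = (\<Sum>a=1..m. \<Sum>y\<in>?P. p a * (of_bool (Q (y(Suc n := a))) * (\<Prod>l\<in>{1..n}. p (y l))))"
    by (simp add: g_def mult_ac)
  finally show ?thesis by (simp add: word_weight_def sum_distrib_left)
qed

lemma word_weight_False: "word_weight m p n (\<lambda>_. False) = 0"
  by (simp add: word_weight_def)

text \<open>Evaluates the sum over the last letter when what remains depends only on whether that
  letter lies in \<open>B\<close>.\<close>

lemma sum_last_letter:
  fixes m :: nat
  assumes "(\<Sum>a=1..m. p a) = (1::real)" "B \<subseteq> {1..m}"
  shows "(\<Sum>a=1..m. if a \<in> B then p a * c else p a * d) = sum p B * c + (1 - sum p B) * d"
proof -
  have "{1..m} \<inter> {a. a \<in> B} = B" "{1..m} \<inter> - {a. a \<in> B} = {1..m} - B" using assms(2) by auto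
  moreover have "sum p ({1..m} - B) = 1 - sum p B"
    using assms by (simp add: sum_diff)
  ultimately show ?thesis
    by (subst sum.If_cases) (simp_all flip: sum_distrib_right)
qed

lemma avoids_upd_Suc: "avoids (Suc n) (y(Suc n := a)) B \<longleftrightarrow> a \<notin> B \<and> avoids n y B"
  unfolding avoids_def atLeastAtMostSuc_conv[of 1 n, simplified] by auto

lemma word_weight_avoids:
  assumes "(\<Sum>a=1..m. p a) = 1" "B \<subseteq> {1..m}"
  shows "word_weight m p n (\<lambda>y. avoids n y B) = (1 - sum p B) ^ n"
proof (induction n)
  case 0
  then show ?case by (simp add: word_weight_def avoids_def)
next
  case (Suc n)
  have "word_weight m p (Suc n) (\<lambda>y. avoids (Suc n) y B) =
      (\<Sum>a=1..m. if a \<in> B then p a * 0 else p a * (1 - sum p B) ^ n)"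
    unfolding word_weight_Suc avoids_upd_Suc
    by (intro sum.cong) (simp_all add: word_weight_False Suc)
  then show ?case by (subst (asm) sum_last_letter[OF assms]) simp
qed

text \<open>A final \<open>i\<close> is compatible only with no \<open>j\<close> before it, and then
  precedence is vacuous. Any other final letter, \<open>j\<close> included, creates no
  violation.\<close>

lemma precedes_upd_Suc:
  assumes "i \<noteq> j"
  shows "precedes (Suc n) (y(Suc n := a)) i j \<longleftrightarrow>
    (if a = i then avoids n y {j} else precedes n y i j)"
proof -
  have "precedes n y i j" if "avoids n y {j}" using that by (auto simp: precedes_def avoids_def)
  moreover have "{1..Suc n} = insert (Suc n) {1..n}" by auto
  ultimately show ?thesis
    using assms unfolding precedes_def avoids_def by (auto simp: not_less_eq_eq)
qed

lemma word_weight_precedes_Suc: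
  assumes "(\<Sum>a=1..m. p a) = 1" "i \<in> {1..m}" "j \<in> {1..m}" "i \<noteq> j"
  shows "word_weight m p (Suc n) (\<lambda>y. precedes (Suc n) y i j) =
    p i * (1 - p j) ^ n + (1 - p i) * word_weight m p n (\<lambda>y. precedes n y i j)"
proof -
  have "word_weight m p (Suc n) (\<lambda>y. precedes (Suc n) y i j) =
      (\<Sum>a=1..m. if a \<in> {i} then p a * (1 - p j) ^ n
        else p a * word_weight m p n (\<lambda>y. precedes n y i j))"
    unfolding word_weight_Suc precedes_upd_Suc[OF assms(4)]
    using word_weight_avoids[OF assms(1), of "{j}" n] assms(3)
    by (intro sum.cong) simp_all
  then show ?thesis using sum_last_letter[OF assms(1), of "{i}"] assms(2) by simp
qed

lemma word_weight_precedes_0: "word_weight m p 0 (\<lambda>y. precedes 0 y i j) = 1"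
  by (simp add: word_weight_def precedes_def)

subsection \<open>Binomial sums\<close>

lemma binomial_transform_Suc:
  "binomial_transform q f (Suc n) =
     q * binomial_transform q f n + binomial_transform q (\<lambda>k. f (Suc k)) n"
proof -
  have "binomial_transform q f (Suc n) =
      (f 0 * q ^ Suc n + (\<Sum>k\<le>n. real (n choose Suc k) * f (Suc k) * q ^ (n - k)))
      + binomial_transform q (\<lambda>k. f (Suc k)) n"
    by (simp only: binomial_transform_def sum.atMost_Suc_shift)
       (simp add: algebra_simps sum.distrib)
  also have "f 0 * q ^ Suc n + (\<Sum>k\<le>n. real (n choose Suc k) * f (Suc k) * q ^ (n - k)) =
      (\<Sum>k\<le>Suc n. real (n choose k) * f k * q ^ (Suc n - k))"
    by (subst sum.atMost_Suc_shift) simp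
  \<comment> \<open>The top term has binomial coefficient 0; in the others
    \<open>Suc n - k = Suc (n - k)\<close> releases a factor \<open>q\<close>.\<close>
  also have "\<dots> = q * binomial_transform q f n"
    by (simp add: binomial_transform_def sum_distrib_left binomial_eq_0)
      (auto intro!: sum.cong simp: Suc_diff_le)
  finally show ?thesis .
qed

lemma binomial_transform_power: "binomial_transform q (\<lambda>k. c ^ k) n = (c + q) ^ n"
  by (simp add: binomial_transform_def binomial_ring)

lemma binomial_transform_add:
  "binomial_transform q (\<lambda>k. f k + g k) n = binomial_transform q f n + binomial_transform q g n"
  by (simp add: binomial_transform_def algebra_simps sum.distrib)

lemma binomial_transform_scale:
  "binomial_transform q (\<lambda>k. c * f k) n = c * binomial_transform q f n"
  by (simp add: binomial_transform_def sum_distrib_left mult_ac)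

subsection \<open>The weight of the words with an edge\<close>

text \<open>Combinatorially, \<open>k\<close> counts the positions carrying \<open>i\<close> or
  \<open>j\<close>, and the letters there must read i^r j^(k-r) for some
  \<open>r \<le> k\<close>.\<close>

lemma word_weight_precedes:
  assumes "(\<Sum>a=1..m. p a) = 1" "i \<in> {1..m}" "j \<in> {1..m}" "i \<noteq> j"
  shows "word_weight m p n (\<lambda>y. precedes n y i j) =
    binomial_transform (1 - (p i + p j)) (\<lambda>k. \<Sum>r\<le>k. p i ^ r * p j ^ (k - r)) n"
proof (induction n)
  case 0
  then show ?case by (simp add: word_weight_precedes_0 binomial_transform_def)
next
  case (Suc n)
  \<comment> \<open>Splitting off the summand \<open>r = Suc k\<close> makes the two recursions
    agree, because \<open>q + p j = 1 - p i\<close> and \<open>p i + q = 1 - p j\<close> for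
    \<open>q = 1 - (p i + p j)\<close>.\<close>
  have "(\<lambda>k. \<Sum>r\<le>Suc k. p i ^ r * p j ^ (Suc k - r)) =
      (\<lambda>k. p j * (\<Sum>r\<le>k. p i ^ r * p j ^ (k - r)) + p i * p i ^ k)"
    by (rule ext) (auto intro!: sum.cong simp: sum_distrib_left Suc_diff_le)
  then show ?case
    by (simp add: word_weight_precedes_Suc[OF assms] binomial_transform_Suc binomial_transform_add
        binomial_transform_scale binomial_transform_power Suc algebra_simps)
qed

text \<open>With equal probabilities the forcing term \<open>c * (1 - c) ^ n\<close> is resonant
  with the homogeneous solution, whence the factor \<open>n\<close>. That factor also neutralises
  the truncated \<open>n - 1\<close> at \<open>n = 0\<close>.\<close>

lemma word_weight_precedes_uniform:
  assumes "(\<Sum>a=1..m. p a) = 1" "i \<in> {1..m}" "j \<in> {1..m}" "i \<noteq> j" "p i = c" "p j = c"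
  shows "word_weight m p n (\<lambda>y. precedes n y i j) = (1 - c) ^ n + real n * c * (1 - c) ^ (n - 1)"
proof (induction n)
  case 0
  then show ?case by (simp add: word_weight_precedes_0)
next
  case (Suc n)
  then show ?case
    by (cases n) (simp_all add: word_weight_precedes_Suc[OF assms(1-4)] assms(5,6) algebra_simps)
qed

lemma word_weight_edge:
  assumes "(\<Sum>a=1..m. p a) = 1" "i \<in> {1..m}" "j \<in> {1..m}" "i \<noteq> j"
  shows "word_weight m p n (\<lambda>y. {i, j} \<in> nerve_edges m n y) =
    1 - word_weight m p n (\<lambda>y. precedes n y i j) - word_weight m p n (\<lambda>y. precedes n y j i)
    + (1 - p i) ^ n + (1 - p j) ^ n - (1 - (p i + p j)) ^ n"
proof -
  have "avoids n y {i, j} \<longleftrightarrow> avoids n y {i} \<and> avoids n y {j}" for y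
    by (auto simp: avoids_def)
  \<comment> \<open>The overlap of the two precedence events is itself a union of two absence
    events, so inclusion-exclusion is applied twice. The constant 1 is written as
    \<open>avoids n y {}\<close> so that \<open>word_weight_avoids\<close> evaluates it too.\<close>
  then have pointwise: "(of_bool ({i, j} \<in> nerve_edges m n y) :: real) =
      of_bool (avoids n y {}) - of_bool (precedes n y i j) - of_bool (precedes n y j i)
      + of_bool (avoids n y {i}) + of_bool (avoids n y {j}) - of_bool (avoids n y {i, j})" for y
    using precedes_both_iff[OF assms(4), of n y] edge_iff_not_precedes[OF assms(2-4), of n y]
    by (auto simp: avoids_def)
  have "word_weight m p n (\<lambda>y. {i, j} \<in> nerve_edges m n y) =
      word_weight m p n (\<lambda>y. avoids n y {}) - word_weight m p n (\<lambda>y. precedes n y i j)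
      - word_weight m p n (\<lambda>y. precedes n y j i) + word_weight m p n (\<lambda>y. avoids n y {i})
      + word_weight m p n (\<lambda>y. avoids n y {j}) - word_weight m p n (\<lambda>y. avoids n y {i, j})"
    unfolding word_weight_def pointwise
    by (simp add: algebra_simps sum.distrib sum_subtractf)
  then show ?thesis using assms by (simp add: word_weight_avoids)
qed

subsection \<open>From weights to probabilities\<close>

text \<open>The event is a finite disjoint union of the atoms \<open>E y\<close>, whose
  probabilities factor by independence. The hypothesis \<open>local\<close> lets the random word be
  cut down to the positions \<open>{1..n}\<close>.\<close>

lemma (in prob_space) prob_eq_word_weight:
  assumes indep: "indep_vars (\<lambda>_. count_space {1..m}) Y {1..n}" and "n \<ge> 1"
    and dist: "\<And>l a. l \<in> {1..n} \<Longrightarrow> a \<in> {1..m} \<Longrightarrow> prob {\<omega> \<in> space M. Y l \<omega> = a} = p a"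
    and local: "\<And>y z. (\<And>l. l \<in> {1..n} \<Longrightarrow> y l = z l) \<Longrightarrow> Q y = Q z"
  shows "prob {\<omega> \<in> space M. Q (\<lambda>l. Y l \<omega>)} = word_weight m p n Q"
proof -
  \<comment> \<open>Since \<open>n \<ge> 1\<close>, the intersection has a nonempty index set and
    stays inside \<open>space M\<close>.\<close>
  define E where "E y = (\<Inter>l\<in>{1..n}. Y l -` {y l} \<inter> space M)" for y
  let ?W = "{y \<in> {1..n} \<rightarrow>\<^sub>E {1..m}. Q y}"
  have fin: "finite ?W" by (simp add: finite_PiE)
  have meas: "Y l \<in> measurable M (count_space {1..m})" if "l \<in> {1..n}" for l
    using indep_vars_def2[THEN iffD1, OF indep] that by auto
  have E: "E y \<in> events" "prob (E y) = (\<Prod>l\<in>{1..n}. p (y l))" if "y \<in> {1..n} \<rightarrow>\<^sub>E {1..m}" for y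
  proof -
    have y: "y l \<in> {1..m}" if "l \<in> {1..n}" for l using that \<open>y \<in> _\<close> by auto
    show "E y \<in> events" unfolding E_def using \<open>n \<ge> 1\<close> y
      by (intro sets.finite_INT measurable_sets[OF meas]) auto
    have "prob (E y) = (\<Prod>l\<in>{1..n}. prob (Y l -` {y l} \<inter> space M))"
      unfolding E_def using y \<open>n \<ge> 1\<close> by (intro indep_varsD[OF indep]) auto
    also have "\<dots> = (\<Prod>l\<in>{1..n}. p (y l))"
    proof (rule prod.cong)
      fix l assume "l \<in> {1..n}"
      moreover have "Y l -` {y l} \<inter> space M = {\<omega> \<in> space M. Y l \<omega> = y l}" by auto
      ultimately show "prob (Y l -` {y l} \<inter> space M) = p (y l)" using dist y by simp
    qed simp
    finally show "prob (E y) = (\<Prod>l\<in>{1..n}. p (y l))" .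
  qed
  have "{\<omega> \<in> space M. Q (\<lambda>l. Y l \<omega>)} = (\<Union>y\<in>?W. E y)"
  proof (intro equalityI subsetI)
    fix \<omega> assume \<omega>: "\<omega> \<in> {\<omega> \<in> space M. Q (\<lambda>l. Y l \<omega>)}"
    define y where "y = restrict (\<lambda>l. Y l \<omega>) {1..n}"
    have "Q y" using \<omega> local[of y "\<lambda>l. Y l \<omega>"] by (simp add: y_def)
    moreover have "y \<in> {1..n} \<rightarrow>\<^sub>E {1..m}"
      using \<omega> measurable_space[OF meas] by (auto simp: y_def)
    moreover have "\<omega> \<in> E y" using \<omega> \<open>n \<ge> 1\<close> by (auto simp: E_def y_def)
    ultimately show "\<omega> \<in> (\<Union>y\<in>?W. E y)" by blast
  next
    fix \<omega> assume "\<omega> \<in> (\<Union>y\<in>?W. E y)"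
    then obtain y where y: "Q y" "\<omega> \<in> E y" by auto
    then have "Q (\<lambda>l. Y l \<omega>)" using local[of y "\<lambda>l. Y l \<omega>"] \<open>n \<ge> 1\<close> by (auto simp: E_def)
    moreover have "\<omega> \<in> space M" using y \<open>n \<ge> 1\<close> by (auto simp: E_def)
    ultimately show "\<omega> \<in> {\<omega> \<in> space M. Q (\<lambda>l. Y l \<omega>)}" by simp
  qed
  also have "prob \<dots> = (\<Sum>y\<in>?W. prob (E y))"
  proof (rule finite_measure_finite_Union[OF fin])
    show "E ` ?W \<subseteq> events" using E by auto
    show "disjoint_family_on E ?W"
      unfolding disjoint_family_on_def
    proof (intro ballI impI)
      fix y z assume "y \<in> ?W" "z \<in> ?W" "y \<noteq> z"
      then obtain l where "l \<in> {1..n}" "y l \<noteq> z l"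
        by (metis (no_types, lifting) PiE_ext mem_Collect_eq)
      then show "E y \<inter> E z = {}" by (auto simp: E_def)
    qed
  qed
  also have "\<dots> = (\<Sum>y\<in>?W. \<Prod>l\<in>{1..n}. p (y l))"
    by (rule sum.cong) (use E in auto)
  also have "\<dots> = word_weight m p n Q"
    unfolding word_weight_def
    by (subst sum.inter_filter) (auto simp: finite_PiE of_bool_def intro!: sum.cong)
  finally show ?thesis .
qed

theorem theorem7:
  fixes m n i j :: nat
    and p :: "nat \<Rightarrow> real"
    and M :: "'a measure"
    and Y :: "nat \<Rightarrow> 'a \<Rightarrow> nat"
  assumes "m \<ge> 1" and "n \<ge> 1"
    and "\<And>a. a \<in> {1..m} \<Longrightarrow> p a > 0"
    and "(\<Sum>a=1..m. p a) = 1"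
    and "prob_space M"
    and "prob_space.indep_vars M (\<lambda>_. count_space {1..m}) Y {1..n}"
    and "\<And>l a. l \<in> {1..n} \<Longrightarrow> a \<in> {1..m} \<Longrightarrow>
           measure M {\<omega> \<in> space M. Y l \<omega> = a} = p a"
    and "1 \<le> i" and "i < j" and "j \<le> m"
  shows "let A = {\<omega> \<in> space M. {i, j} \<in> nerve_edges m n (\<lambda>l. Y l \<omega>)};
             q = 1 - (p i + p j)
         in measure M A =
              1 - q ^ n - (\<Sum>k=1..n. real (n choose k) *
                ((2 * (\<Sum>r=1..k-1. p i ^ r * p j ^ (k - r))) + p i ^ k + p j ^ k) * q ^ (n - k))
          \<and> ((\<forall>a\<in>{1..m}. p a = 1 / real m) \<longrightarrow>
              measure M A =
                1 - (2 * real n * (real m - 1) ^ (n - 1) + (real m - 2) ^ n) / real m ^ n)"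
proof -
  interpret prob_space M by fact
  define q where "q = 1 - (p i + p j)"
  define u where "u i j = word_weight m p n (\<lambda>y. precedes n y i j)" for i j
  define f where "f a b k = (\<Sum>r\<le>k. a ^ r * b ^ (k - r))" for a b :: real and k
  define h where "h k = 2 * (\<Sum>r=1..k-1. p i ^ r * p j ^ (k - r)) + p i ^ k + p j ^ k" for k
  have ij: "i \<in> {1..m}" "j \<in> {1..m}" "i \<noteq> j" using assms(8-10) by auto
  note sum1 = assms(4)
  have "measure M {\<omega> \<in> space M. {i, j} \<in> nerve_edges m n (\<lambda>l. Y l \<omega>)} =
      word_weight m p n (\<lambda>y. {i, j} \<in> nerve_edges m n y)"
  proof (rule prob_eq_word_weight[OF assms(6) \<open>n \<ge> 1\<close> assms(7)])
    fix y z :: "nat \<Rightarrow> nat" assume "\<And>l. l \<in> {1..n} \<Longrightarrow> y l = z l"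
    then show "({i, j} \<in> nerve_edges m n y) = ({i, j} \<in> nerve_edges m n z)"
      by (simp add: edge_iff_not_precedes[OF ij] precedes_def)
  qed
  also have "\<dots> = 1 - u i j - u j i + (1 - p i) ^ n + (1 - p j) ^ n - q ^ n"
    by (simp add: word_weight_edge[OF sum1 ij] u_def q_def)
  finally have main: "measure M {\<omega> \<in> space M. {i, j} \<in> nerve_edges m n (\<lambda>l. Y l \<omega>)} = \<dots>" .
  \<comment> \<open>Reversing \<open>r\<close> to \<open>k - r\<close> shows that both orders of
    precedence have the same weight: the source of the factor 2.\<close>
  have "f b a = f a b" for a b
    unfolding f_def by (rule ext, subst sum.atLeastAtMost_rev[of _ 0, folded atMost_atLeast0])
      (auto intro!: sum.cong simp: mult_ac)
  then have u: "u i j = binomial_transform q (f (p i) (p j)) n"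
      "u j i = binomial_transform q (f (p i) (p j)) n"
    using word_weight_precedes[OF sum1 ij] word_weight_precedes[OF sum1 ij(2,1) ij(3)[symmetric]]
    by (simp_all add: u_def q_def f_def[abs_def] add.commute)
  \<comment> \<open>Doubling \<open>f\<close> counts each of the end terms \<open>r = 0\<close> and
    \<open>r = k\<close> twice, whereas \<open>h\<close> has them once. At \<open>k = 0\<close> the
    end terms coincide, so that index is treated apart.\<close>
  have h: "2 * f (p i) (p j) k = p i ^ k + p j ^ k + h k" if "k \<ge> 1" for k
  proof -
    obtain k' where k: "k = Suc k'" using \<open>k \<ge> 1\<close> by (cases k) auto
    have "(\<Sum>r\<le>k. p i ^ r * p j ^ (k - r)) = p j ^ k + (\<Sum>r=1..k'. p i ^ r * p j ^ (k - r)) + p i ^ k"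
      unfolding k atMost_atLeast0 by (simp add: sum.atLeast_Suc_atMost)
    then show ?thesis by (simp add: f_def h_def k)
  qed
  have split0: "binomial_transform q g n = g 0 * q ^ n + (\<Sum>k=1..n. real (n choose k) * g k * q ^ (n - k))"
    for g
    unfolding binomial_transform_def atMost_atLeast0 by (simp add: sum.atLeast_Suc_atMost)
  have "u i j + u j i = 2 * binomial_transform q (f (p i) (p j)) n" by (simp add: u)
  also have "\<dots> = 2 * q ^ n + (\<Sum>k=1..n. real (n choose k) * (p i ^ k + p j ^ k + h k) * q ^ (n - k))"
    unfolding split0[of "f (p i) (p j)"]
    by (simp add: distrib_left sum_distrib_left f_def[of _ _ 0] flip: h) (simp add: mult_ac)
  \<comment> \<open>The surplus pure powers absorb \<open>2 * q ^ n\<close> as their terms at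
    \<open>k = 0\<close>; the resulting transforms cancel the two single-letter absence terms in
    \<open>main\<close>.\<close>
  also have "\<dots> = binomial_transform q (\<lambda>k. p i ^ k) n + binomial_transform q (\<lambda>k. p j ^ k) n
      + (\<Sum>k=1..n. real (n choose k) * h k * q ^ (n - k))"
    unfolding split0 by (simp add: algebra_simps sum.distrib)
  also have "\<dots> = (1 - p j) ^ n + (1 - p i) ^ n + (\<Sum>k=1..n. real (n choose k) * h k * q ^ (n - k))"
    by (simp add: binomial_transform_power q_def)
  finally have general: "measure M {\<omega> \<in> space M. {i, j} \<in> nerve_edges m n (\<lambda>l. Y l \<omega>)} =
      1 - q ^ n - (\<Sum>k=1..n. real (n choose k) * h k * q ^ (n - k))"
    unfolding main by simp
  have uniform: "measure M {\<omega> \<in> space M. {i, j} \<in> nerve_edges m n (\<lambda>l. Y l \<omega>)} =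
      1 - (2 * real n * (real m - 1) ^ (n - 1) + (real m - 2) ^ n) / real m ^ n"
    if unif: "\<forall>a\<in>{1..m}. p a = 1 / real m"
  proof -
    have p: "p i = 1 / real m" "p j = 1 / real m" using unif ij by auto
    have m: "real m > 0" using \<open>m \<ge> 1\<close> by simp
    have "u i j = (1 - 1 / m) ^ n + real n * (1 / m) * (1 - 1 / m) ^ (n - 1)"
        "u j i = (1 - 1 / m) ^ n + real n * (1 / m) * (1 - 1 / m) ^ (n - 1)"
      unfolding u_def
      using word_weight_precedes_uniform[OF sum1 ij p]
        word_weight_precedes_uniform[OF sum1 ij(2,1) ij(3)[symmetric] p(2,1)] by simp_all
    \<comment> \<open>The powers \<open>(1 - 1 / m) ^ n\<close> from the two precedence weights
      cancel the absence terms.\<close>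
    then have "measure M {\<omega> \<in> space M. {i, j} \<in> nerve_edges m n (\<lambda>l. Y l \<omega>)} =
        1 - (2 * real n * (1 / m) * (1 - 1 / m) ^ (n - 1) + q ^ n)"
      unfolding main p by simp
    moreover have "1 - 1 / m = (real m - 1) / m" "q = (real m - 2) / m"
      using m by (simp_all add: q_def p field_simps)
    \<comment> \<open>This merges the separate factor \<open>1 / m\<close> with the denominator of
      the power \<open>n - 1\<close>.\<close>
    moreover have "real m ^ n = real m * real m ^ (n - 1)" using \<open>n \<ge> 1\<close> by (cases n) auto
    ultimately show ?thesis
      by (simp add: power_divide add_divide_distrib)
  qed
  show ?thesis
    using general uniform by (simp add: Let_def h_def q_def)
qed

end
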